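(* Let $n\ge1$, $0<k\le1$, and let $P\in\mathscr P_n$ have no zero in the disk $|z|<k$. Then for all $\alpha,\beta\in\mathbb C$ with $|\alpha|\le1$, $|\beta|\le1$, all $R>r\ge k$ and all $|z|\ge1$, writing $\Phi=\Phi_k(R,r,\alpha,\beta)$, $$\big|B[P\circ\sigma](z)+\Phi B[P\circ\rho](z)\big|\le\frac12\left[\frac{|B[z^n]|}{k^n}|R^n+r^n\Phi|+|1+\Phi|\,|\lambda_0|\right]\max_{|z|=k}|P(z)|.$$
   Context: For an integer $n\ge1$, $\mathscr P_n$ denotes the set of complex polynomials of degree at most $n$. Fix complex numbers $\lambda_0,\lambda_1,\lambda_2$ such that all zeros of $U(z)=\lambda_0+n\lambda_1 z+\frac{n(n-1)}{2}\lambda_2 z^2$ lie in the half-plane $\{z\in\mathbb C:|z|\le|z-n/2|\}$. The operator $B$ (of the class $\mathcal B_n$) sends $P\in\mathscr P_n$ to $B[P](z)=\lambda_0P(z)+\lambda_1\frac{nz}{2}P'(z)+\lambda_2\left(\frac{nz}{2}\right)^2\frac{P''(z)}{2!}$. For a polynomial $P$ and a map $\rho$, $P\circ\rho$ denotes $z\mapsto P(\rho(z))$, and $B[P\circ\rho](z)$ is $B$ applied to the polynomial $P\circ\rho$, evaluated at $z$. $B[z^n]$ denotes $B$ applied to the monomial $z\mapsto z^n$, evaluated at the point $z$ under consideration; thus $|B[z^n]|=|z|^n\,|\lambda_0+\lambda_1 n^2/2+\lambda_2 n^3(n-1)/8|$. For $k>0$, $R,r>0$ and $\alpha,\beta\in\mathbb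 C$: $\Phi_k(R,r,\alpha,\beta)=\beta\left\{\left(\frac{R+k}{k+r}\right)^n-|\alpha|\right\}-\alpha$; and $\sigma(z)=Rz$, $\rho(z)=rz$. *)

theory Defs
  imports "HOL-Analysis.Analysis" "HOL-Computational_Algebra.Polynomial"
begin

definition Bop :: "nat \<Rightarrow> complex \<Rightarrow> complex \<Rightarrow> complex \<Rightarrow> complex poly \<Rightarrow> complex \<Rightarrow> complex" where
  "Bop n l0 l1 l2 p z =
     l0 * poly p z + l1 * (of_nat n * z / 2) * poly (pderiv p) z
     + l2 * (of_nat n * z / 2)^2 * poly (pderiv (pderiv p)) z / 2"

definition Upoly :: "nat \<Rightarrow> complex \<Rightarrow> complex \<Rightarrow> complex \<Rightarrow> complex \<Rightarrow> complex" where
  "Upoly n l0 l1 l2 z = l0 + of_nat n * l1 * z + of_nat (n * (n - 1)) / 2 * l2 * z^2"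

definition Phi :: "nat \<Rightarrow> real \<Rightarrow> real \<Rightarrow> real \<Rightarrow> complex \<Rightarrow> complex \<Rightarrow> complex" where
  "Phi n k R r \<alpha> \<beta> = \<beta> * (complex_of_real (((R + k) / (k + r))^n - cmod \<alpha>)) - \<alpha>"

end

theory Submission
  imports Defs "HOL-Complex_Analysis.Complex_Analysis"
    "HOL-Computational_Algebra.Fundamental_Theorem_Algebra"
begin

text \<open>
  Let \<open>L\<close> send \<open>p\<close> to \<open>B[p(R z) + \<Phi> p(r z)]\<close>. Both stages of \<open>L\<close> preserve location of zeros: if \<open>p\<close>
  has exact degree \<open>n\<close> and all zeros in \<open>|z| \<le> k\<close>, then \<open>|\<Phi>| \<le> ((R+k)/(r+k))^n\<close> and a comparison of
  linear factors put the zeros of \<open>p(R z) + \<Phi> p(r z)\<close> in \<open>|z| \<le> 1\<close>; writing \<open>B[p]/p\<close> in terms of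
  \<open>u\<^sub>j = z/(z - a\<^sub>j)\<close>, which has real part above \<open>1/2\<close> when \<open>|z| > 1\<close>, gives a polarization of \<open>U\<close>,
  which cannot vanish. Applied to \<open>f - \<mu> F\<close> with \<open>|\<mu>| > 1\<close> this shows that \<open>|f| \<le> |F|\<close> on \<open>|z| > k\<close>
  implies \<open>|L f| \<le> |L F|\<close> on \<open>|z| \<ge> 1\<close>.

  Let \<open>Q\<close> be the reflection of \<open>P\<close> in \<open>|z| = k\<close>, \<open>M\<close> the maximum of \<open>|P|\<close> on that circle, and
  \<open>W = L(z^n)/k^n\<close>. Then \<open>|L P| \<le> |L Q| \<le> M |W|\<close>. For \<open>|\<gamma>| > 1\<close> the polynomial \<open>P - \<gamma> M\<close> has no zero in
  \<open>|z| \<le> k\<close> and its reflection is \<open>Q - cnj \<gamma> M (z/k)^n\<close>; choosing the argument of \<open>\<gamma>\<close> to align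
  \<open>L Q\<close> with the subtracted term and letting \<open>|\<gamma>|\<close> tend to \<open>1\<close> yields
  \<open>|L P| + |L Q| \<le> M (|W| + |1 + \<Phi>| |\<lambda>\<^sub>0|)\<close>.
\<close>

section \<open>Zeros of the operator \<open>B\<close>\<close>

text \<open>Inversion preserves the right half-plane, and \<open>x * y / (x + y)\<close> is the
  inverse of the sum of the inverses.\<close>

lemma Re_parallel_sum_pos:
  fixes x y :: complex
  assumes "Re x > 0" "Re y > 0"
  shows "Re (x * y / (x + y)) > 0"
proof -
  have pos: "Re (inverse w) > 0" if "Re w > 0" for w :: complex
  proof -
    have "(Re w)^2 + (Im w)^2 > 0"
      using that by (simp add: sum_power2_gt_zero_iff)
    then show ?thesis
      using that by (simp add: divide_pos_pos)
  qed
  have nz: "x \<noteq> 0" "y \<noteq> 0"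
    using assms by auto
  have "Re (x + y) > 0"
    using assms by simp
  then have "x + y \<noteq> 0"
    by (metis less_irrefl zero_complex.sel(1))
  then have "x * y / (x + y) = inverse (inverse x + inverse y)"
    using nz by (simp add: field_simps)
  moreover have "Re (inverse x + inverse y) > 0"
    using pos[OF assms(1)] pos[OF assms(2)] by (metis add_pos_pos plus_complex.sel(1))
  ultimately show ?thesis
    using pos by presburger
qed

text \<open>The expression is the sum of \<open>(w i - t1) * (w j - t2)\<close> over all
  \<open>i\<close>, \<open>j\<close> below \<open>n\<close> with \<open>i\<close> different from
  \<open>j\<close>. Shifting by the root with the larger real part and dividing by the total
  \<open>X\<close> turns it into parallel sums of \<open>x j\<close> and \<open>X - x j\<close>, all
  with positive real part, plus a term with nonnegative real part.\<close>

lemma polarized_quadratic_nonzero_ordered: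
  fixes w :: "nat \<Rightarrow> complex" and t1 t2 :: complex and c :: real
  assumes n: "n \<ge> 2" and w: "\<And>j. j < n \<Longrightarrow> Re (w j) > c"
    and t: "Re t1 \<le> c" "Re t2 \<le> Re t1"
  shows "of_nat n * of_nat (n - 1) * t1 * t2 - of_nat (n - 1) * (t1 + t2) * (\<Sum>j<n. w j)
    + ((\<Sum>j<n. w j)^2 - (\<Sum>j<n. (w j)^2)) \<noteq> 0"
proof -
  define x where "x j = w j - t1" for j
  define X where "X = (\<Sum>j<n. x j)"
  have x: "Re (x j) > 0" if "j < n" for j
    using w[OF that] t by (simp add: x_def)
  \<comment> \<open>Since \<open>n\<close> is at least 2, removing one term leaves a nonempty
    sum.\<close>
  have rest: "Re (X - x j) > 0" if "j < n" for j
  proof -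
    have "X - x j = (\<Sum>i\<in>{..<n} - {j}. x i)"
      unfolding X_def using that by (simp add: sum_diff1)
    moreover have "(\<Sum>i\<in>{..<n} - {j}. Re (x i)) > 0"
    proof (rule sum_pos)
      have "card ({..<n} - {j}) = n - 1"
        using that by simp
      with n show "{..<n} - {j} \<noteq> {}"
        by (metis card.empty not_numeral_le_zero diff_is_0_eq numeral_le_one_iff semiring_norm(69) le_trans)
    qed (use x in auto)
    ultimately show ?thesis
      by simp
  qed
  have "Re X > 0"
    using rest[of 0] x[of 0] n by simp
  then have X: "X \<noteq> 0"
    by auto
  have "Re (\<Sum>j<n. x j * (X - x j) / X) > 0"
    unfolding Re_sum
  proof (rule sum_pos)
    fix j assume "j \<in> {..<n}"
    then show "Re (x j * (X - x j) / X) > 0"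
      using Re_parallel_sum_pos[of "x j" "X - x j"] x rest by simp
  qed (use n in \<open>auto simp: lessThan_empty_iff\<close>)
  moreover have "Re (of_nat (n - 1) * (t1 - t2)) \<ge> 0"
    using t by simp
  ultimately have "Re ((\<Sum>j<n. x j * (X - x j) / X) + of_nat (n - 1) * (t1 - t2)) > 0"
    by (metis add_pos_nonneg plus_complex.sel(1))
  then have nz: "(\<Sum>j<n. x j * (X - x j) / X) + of_nat (n - 1) * (t1 - t2) \<noteq> 0"
    by (metis less_irrefl zero_complex.sel(1))
  have sumx: "(\<Sum>j<n. x j * (X - x j) / X) = (X^2 - (\<Sum>j<n. (x j)^2)) / X"
    by (simp add: sum_divide_distrib [symmetric] right_diff_distrib sum_subtractf
        sum_distrib_right [symmetric] X_def [symmetric] power2_eq_square)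
  have S1: "(\<Sum>j<n. w j) = X + of_nat n * t1"
    by (simp add: X_def x_def sum_subtractf)
  have "(\<Sum>j<n. (w j)^2) = (\<Sum>j<n. (x j)^2 + 2 * t1 * x j + t1^2)"
    by (intro sum.cong) (auto simp: x_def power2_eq_square algebra_simps)
  then have S2: "(\<Sum>j<n. (w j)^2) = (\<Sum>j<n. (x j)^2) + 2 * t1 * X + of_nat n * t1^2"
    by (simp add: sum.distrib sum_distrib_left X_def)
  have n1: "of_nat (n - 1) = (of_nat n - 1 :: complex)"
    using n by (simp add: of_nat_diff)
  have "of_nat n * of_nat (n - 1) * t1 * t2 - of_nat (n - 1) * (t1 + t2) * (\<Sum>j<n. w j)
      + ((\<Sum>j<n. w j)^2 - (\<Sum>j<n. (w j)^2))
      = X^2 - (\<Sum>j<n. (x j)^2) + of_nat (n - 1) * (t1 - t2) * X"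
    unfolding S1 S2 n1 by (simp add: power2_eq_square algebra_simps)
  also have "\<dots> = X * ((\<Sum>j<n. x j * (X - x j) / X) + of_nat (n - 1) * (t1 - t2))"
    unfolding sumx distrib_left using X by (simp add: mult.commute)
  finally show ?thesis
    using nz X by simp
qed

text \<open>The expression is symmetric in \<open>t1\<close> and \<open>t2\<close>, so their order
  may be chosen.\<close>

lemma polarized_quadratic_nonzero:
  fixes w :: "nat \<Rightarrow> complex" and t1 t2 :: complex and c :: real
  assumes "n \<ge> 2" and "\<And>j. j < n \<Longrightarrow> Re (w j) > c" and "Re t1 \<le> c" "Re t2 \<le> c"
  shows "of_nat n * of_nat (n - 1) * t1 * t2 - of_nat (n - 1) * (t1 + t2) * (\<Sum>j<n. w j)
    + ((\<Sum>j<n. w j)^2 - (\<Sum>j<n. (w j)^2)) \<noteq> 0"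
proof (cases "Re t2 \<le> Re t1")
  case True
  then show ?thesis
    using polarized_quadratic_nonzero_ordered[of n c w t1 t2] assms by blast
next
  case False
  then show ?thesis
    using polarized_quadratic_nonzero_ordered[of n c w t2 t1] assms
    by (simp add: add.commute mult.commute mult.left_commute)
qed

text \<open>The quadratic formula: coefficient form of a + b x + c x^2 = c (x - t1) (x -
  t2).\<close>

lemma complex_quadratic_factorization:
  fixes a b c :: complex
  assumes "c \<noteq> 0"
  obtains t1 t2 where "b = - c * (t1 + t2)" "a = c * t1 * t2"
proof -
  define s where "s = csqrt (b^2 - 4 * c * a)"
  have s: "s * s = b * b - 4 * c * a"
    unfolding s_def by (metis power2_csqrt power2_eq_square)
  show thesis
  proof
    show "b = - c * ((- b + s) / (2 * c) + (- b - s) / (2 * c))"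
      using assms by (simp add: field_simps)
    have "c * ((- b + s) / (2 * c)) * ((- b - s) / (2 * c)) = (b * b - s * s) / (4 * c)"
      using assms by (simp add: field_simps)
    then show "a = c * ((- b + s) / (2 * c)) * ((- b - s) / (2 * c))"
      using assms by (simp add: s)
  qed
qed

text \<open>The quadratic case of Walsh's coincidence theorem for a half-plane.\<close>

lemma Upoly_polarized_nonzero:
  fixes w :: "nat \<Rightarrow> complex"
  assumes n: "n \<ge> 1"
    and U: "\<forall>x. Upoly n l0 l1 l2 x = 0 \<longrightarrow> Re x \<le> c"
    and w: "\<And>j. j < n \<Longrightarrow> Re (w j) > c"
  shows "l0 + l1 * (\<Sum>j<n. w j) + l2 / 2 * ((\<Sum>j<n. w j)^2 - (\<Sum>j<n. (w j)^2)) \<noteq> 0"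
proof (cases "of_nat (n * (n - 1)) / 2 * l2 = 0")
  \<comment> \<open>Here \<open>n = 1\<close> or \<open>l2 = 0\<close>. Either way the quadratic
    term drops out, and what remains is \<open>Upoly\<close> at the mean of the \<open>w j\<close>,
    which lies in the same half-plane.\<close>
  case True
  then have "n = 1 \<or> l2 = 0"
    using n by (auto simp del: of_nat_mult)
  then have last: "l2 / 2 * ((\<Sum>j<n. w j)^2 - (\<Sum>j<n. (w j)^2)) = 0"
    by (auto simp: lessThan_Suc)
  have "(\<Sum>j<n. c) < (\<Sum>j<n. Re (w j))"
    using n w by (intro sum_strict_mono) (auto simp: lessThan_empty_iff)
  then have "c < Re ((\<Sum>j<n. w j) / of_nat n)"
    using n by (simp add: Re_divide_of_nat field_simps)
  then have "Upoly n l0 l1 l2 ((\<Sum>j<n. w j) / of_nat n) \<noteq> 0"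
    using U by (meson not_less)
  then show ?thesis
    unfolding Upoly_def last True using n by simp
next
  case False
  define q where "q = of_nat (n * (n - 1)) / 2 * l2"
  have q: "q \<noteq> 0" and n2: "n \<ge> 2"
    using False n by (auto simp: q_def intro: ccontr)
  obtain t1 t2 where t: "of_nat n * l1 = - q * (t1 + t2)" "l0 = q * t1 * t2"
    using complex_quadratic_factorization[OF q] .
  have "Upoly n l0 l1 l2 x = q * (x - t1) * (x - t2)" for x
    unfolding Upoly_def q_def [symmetric] t by (simp add: power2_eq_square algebra_simps)
  then have "Re t1 \<le> c" "Re t2 \<le> c"
    using U by auto
  note nz = polarized_quadratic_nonzero[of n c w t1 t2, OF n2 w this]
  have nn: "of_nat n \<noteq> (0::complex)" "of_nat (n - 1) \<noteq> (0::complex)"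
    using n2 by simp_all
  define S where "S = (\<Sum>j<n. w j)"
  define S2 where "S2 = (\<Sum>j<n. (w j)^2)"
  have l1: "l1 = - q * (t1 + t2) / of_nat n"
    using t(1) nn by (simp add: field_simps)
  have l2: "l2 / 2 = q / (of_nat n * of_nat (n - 1))"
    using nn by (simp add: q_def)
  have "l0 + l1 * S + l2 / 2 * (S^2 - S2)
      = q / (of_nat n * of_nat (n - 1)) *
        (of_nat n * of_nat (n - 1) * t1 * t2 - of_nat (n - 1) * (t1 + t2) * S + (S^2 - S2))"
    unfolding l1 l2 t(2) using nn by (simp add: divide_simps) (simp add: algebra_simps)
  then show ?thesis
    using nz q nn by (simp add: S_def S2_def)
qed

text \<open>Logarithmic differentiation: p'/p = s, and p''/p = s^2 + s' with s' equal to minus the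
  sum of the squares. The induction over the factors avoids differentiating quotients.\<close>

lemma poly_derivs_of_roots:
  fixes a :: "nat \<Rightarrow> complex"
  assumes "\<And>j. j < m \<Longrightarrow> z \<noteq> a j"
  defines "p \<equiv> (\<Prod>j<m. [:- a j, 1:])"
  shows "poly (pderiv p) z = poly p z * (\<Sum>j<m. 1 / (z - a j))"
    and "poly (pderiv (pderiv p)) z
      = poly p z * ((\<Sum>j<m. 1 / (z - a j))^2 - (\<Sum>j<m. (1 / (z - a j))^2))"
  using assms(1) unfolding p_def
proof (induction m)
  case (Suc m)
  define f where "f = (\<Prod>j<m. [:- a j, 1:])"
  define s where "s = (\<Sum>j<m. 1 / (z - a j))"
  define s2 where "s2 = (\<Sum>j<m. (1 / (z - a j))^2)"
  define u where "u = 1 / (z - a m)"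
  { case 1
    then have d: "(z - a m) * u = 1"
      by (auto simp: u_def)
    have "poly (pderiv f) z = poly f z * s"
      using Suc.IH(1) 1 by (simp add: f_def s_def)
    then have "poly (pderiv ([:- a m, 1:] * f)) z = poly f z * ((z - a m) * s + 1)"
      by (simp add: pderiv_mult pderiv_pCons algebra_simps del: mult_pCons_left mult_pCons_right)
    \<comment> \<open>Rewriting the 1 from the product rule as \<open>(z - a m) * u\<close> lets the
      new linear factor be pulled out.\<close>
    also have "\<dots> = poly f z * ((z - a m) * s + (z - a m) * u)"
      by (simp only: d)
    also have "\<dots> = poly ([:- a m, 1:] * f) z * (s + u)"
      by (simp only: poly_mult poly_pCons poly_0) (simp add: algebra_simps)
    finally show ?case
      by (simp add: f_def s_def u_def lessThan_Suc add.commute mult.commute del: mult_pCons_left mult_pCons_right)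
  next
    case 2
    then have d: "(z - a m) * u = 1"
      by (auto simp: u_def)
    have "poly (pderiv f) z = poly f z * s" "poly (pderiv (pderiv f)) z = poly f z * (s^2 - s2)"
      using Suc.IH 2 by (simp_all add: f_def s_def s2_def)
    then have "poly (pderiv (pderiv ([:- a m, 1:] * f))) z
        = poly f z * ((z - a m) * (s^2 - s2) + 2 * s * 1)"
      by (simp only: pderiv_mult pderiv_add pderiv_pCons poly_add poly_mult poly_pCons poly_0
          pderiv_0 pderiv_1 pCons_0_0) (simp add: algebra_simps)
    also have "\<dots> = poly f z * ((z - a m) * (s^2 - s2) + 2 * s * ((z - a m) * u))"
      by (simp only: d)
    also have "\<dots> = poly ([:- a m, 1:] * f) z * ((s + u)^2 - (s2 + u^2))"
      by (simp only: poly_mult poly_pCons poly_0) (simp add: power2_sum algebra_simps)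
    finally show ?case
      by (simp add: f_def s_def s2_def u_def lessThan_Suc add.commute mult.commute
          del: mult_pCons_left mult_pCons_right) }
qed (auto simp: pderiv_1)

text \<open>Subtracting 1/2 leaves (z + a) / (2 (z - a)), whose real part is (|z|^2 - |a|^2) / (2 |z
  - a|^2).\<close>

lemma Re_half_less:
  fixes z a :: complex
  assumes "cmod a < cmod z"
  shows "Re (z / (z - a)) > 1/2"
proof -
  have nz: "z - a \<noteq> 0" using assms by auto
  have "Re (z / (z - a)) - 1/2 = Re ((z + a) / (2 * (z - a)))"
  proof -
    have "z / (z - a) - 1/2 = (z + a) / (2 * (z - a))"
      using nz by (simp add: field_simps)
    then show ?thesis by (metis Re_divide_numeral minus_complex.sel(1) one_complex.sel(1))
  qed
  also have "\<dots> = Re ((z + a) / (z - a) / 2)"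
    by (simp add: mult.commute)
  also have "\<dots> = Re ((z + a) / (z - a)) / 2"
    by (rule Re_divide_numeral)
  also have "\<dots> = ((cmod z)^2 - (cmod a)^2) / (cmod (z - a))^2 / 2"
    by (simp only: Re_divide cmod_power2) (simp add: power2_eq_square algebra_simps)
  also have "\<dots> > 0"
    using nz assms by (simp add: power_strict_mono)
  finally show ?thesis by simp
qed

text \<open>The perpendicular bisector of 0 and \<open>h\<close> bounds the half-plane. With
  \<open>h = n / 2\<close> the hypothesis on the zeros of U becomes Re w <= n/4.\<close>

lemma norm_le_norm_diff_real_iff:
  fixes w :: complex and h :: real
  assumes "h > 0"
  shows "cmod w \<le> cmod (w - of_real h) \<longleftrightarrow> Re w \<le> h / 2"
proof -
  have "cmod w \<le> cmod (w - of_real h) \<longleftrightarrow> (cmod w)^2 \<le> (cmod (w - of_real h))^2"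
    by simp
  also have "\<dots> \<longleftrightarrow> h * (2 * Re w) \<le> h * h"
    by (simp only: cmod_power2) (simp add: power2_eq_square algebra_simps)
  also have "\<dots> \<longleftrightarrow> Re w \<le> h / 2"
    using assms by auto
  finally show ?thesis .
qed

text \<open>With a_j the roots of \<open>p\<close>, \<open>Bop\<close> at \<open>z\<close> is p(z)
  times the polarized U at the points (n/2) z / (z - a_j). Their real parts exceed n/4, while the
  zeros of U have real part at most n/4.\<close>

lemma Bop_nonzero:
  assumes n: "n \<ge> 1"
    and U: "\<forall>w. Upoly n l0 l1 l2 w = 0 \<longrightarrow> cmod w \<le> cmod (w - of_nat n / 2)"
    and deg: "degree p = n"
    and zeros: "\<And>w. poly p w = 0 \<Longrightarrow> cmod w \<le> c"
    and z: "cmod z > c"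
  shows "Bop n l0 l1 l2 p z \<noteq> 0"
proof -
  obtain a where a: "smult (lead_coeff p) (\<Prod>j<n. [:- a j, 1:]) = p"
    using complex_poly_decompose'[of p] deg by metis
  define f where "f = (\<Prod>j<n. [:- a j, 1:])"
  have lc: "lead_coeff p \<noteq> 0"
    using deg n by auto
  have p: "p = smult (lead_coeff p) f"
    using a f_def by simp
  have "poly p (a j) = 0" if "j < n" for j
    using that by (subst a [symmetric]) (auto simp: poly_prod)
  then have za: "cmod (a j) < cmod z" if "j < n" for j
    using that zeros z by force
  then have ne: "z \<noteq> a j" if "j < n" for j
    using that by force
  have fz: "poly f z \<noteq> 0"
    using ne by (auto simp: f_def poly_prod)
  \<comment> \<open>The factor n/2 absorbs the weights n z / 2 that accompany the derivatives in
    \<open>Bop\<close>.\<close>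
  define w where "w j = of_nat n / 2 * (z / (z - a j))" for j
  have Rew: "Re (w j) > real n / 4" if "j < n" for j
  proof -
    have "w j = (real n / 2) *\<^sub>R (z / (z - a j))"
      by (simp add: w_def scaleR_conv_of_real)
    then have "Re (w j) = real n / 2 * Re (z / (z - a j))"
      by (simp only: scaleR_complex.sel)
    then show ?thesis
      using mult_strict_left_mono[OF Re_half_less[OF za[OF that]], of "real n / 2"] n
      by (simp only:) (simp add: field_simps)
  qed
  have "Re x \<le> real n / 4" if "Upoly n l0 l1 l2 x = 0" for x
    using U that norm_le_norm_diff_real_iff[of "real n / 2" x] n by simp
  then have nz: "l0 + l1 * (\<Sum>j<n. w j) + l2 / 2 * ((\<Sum>j<n. w j)^2 - (\<Sum>j<n. (w j)^2)) \<noteq> 0"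
    using Rew by (intro Upoly_polarized_nonzero[OF n, where c = "real n / 4"]) auto
  define s where "s = (\<Sum>j<n. 1 / (z - a j))"
  define s2 where "s2 = (\<Sum>j<n. (1 / (z - a j))^2)"
  have w: "w = (\<lambda>j. of_nat n * z / 2 * (1 / (z - a j)))"
    by (simp add: w_def fun_eq_iff)
  have w1: "(\<Sum>j<n. w j) = of_nat n * z / 2 * s"
    by (simp only: w s_def sum_distrib_left)
  have w2: "(\<Sum>j<n. (w j)^2) = (of_nat n * z / 2)^2 * s2"
    by (simp only: w s2_def sum_distrib_left power_mult_distrib)
  have "Bop n l0 l1 l2 p z = lead_coeff p * (poly f z *
    (l0 + l1 * (\<Sum>j<n. w j) + l2 / 2 * ((\<Sum>j<n. w j)^2 - (\<Sum>j<n. (w j)^2))))"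
  proof -
    note d = poly_derivs_of_roots[of n z a, OF ne, folded f_def s_def s2_def]
    have "poly p z = lead_coeff p * poly f z"
      by (subst p) (rule poly_smult)
    moreover have "poly (pderiv p) z = lead_coeff p * (poly f z * s)"
      by (subst p) (simp only: pderiv_smult poly_smult d)
    moreover have "poly (pderiv (pderiv p)) z = lead_coeff p * (poly f z * (s^2 - s2))"
      by (subst p) (simp only: pderiv_smult poly_smult d)
    ultimately show ?thesis
      unfolding w1 w2 Bop_def
      by (simp only:) (simp add: algebra_simps power2_eq_square diff_divide_distrib add_divide_distrib)
  qed
  then show ?thesis
    using nz lc fz by simp
qed

section \<open>Combinations of dilations\<close>

definition dilate :: "real \<Rightarrow> complex poly \<Rightarrow> complex poly" where
  "dilate R p = pcompose p [:0, complex_of_real R:]"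

lemma poly_dilate: "poly (dilate R p) z = poly p (of_real R * z)"
  by (simp add: dilate_def poly_pcompose mult.commute)

lemma coeff_dilate: "coeff (dilate R p) m = of_real R ^ m * coeff p m"
  by (simp add: dilate_def coeff_pcompose_linear)

definition dilation_comb :: "real \<Rightarrow> real \<Rightarrow> complex \<Rightarrow> complex poly \<Rightarrow> complex poly" where
  "dilation_comb R r \<phi> p = dilate R p + smult \<phi> (dilate r p)"

lemma coeff_dilation_comb:
  "coeff (dilation_comb R r \<phi> p) m = (of_real R ^ m + \<phi> * of_real r ^ m) * coeff p m"
  by (simp add: dilation_comb_def coeff_dilate algebra_simps)

lemma dilation_comb_diff_smult:
  "dilation_comb R r \<phi> (p - smult c q) = dilation_comb R r \<phi> p - smult c (dilation_comb R r \<phi> q)"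
  by (rule poly_eqI) (simp add: coeff_dilation_comb algebra_simps)

lemma Bop_diff_smult:
  "Bop n l0 l1 l2 (p - smult c q) z = Bop n l0 l1 l2 p z - c * Bop n l0 l1 l2 q z"
  by (simp add: Bop_def pderiv_diff pderiv_smult algebra_simps add_divide_distrib diff_divide_distrib)

lemma Bop_smult: "Bop n l0 l1 l2 (smult c q) z = c * Bop n l0 l1 l2 q z"
  by (simp add: Bop_def pderiv_smult algebra_simps)

lemma Bop_dilation_comb:
  "Bop n l0 l1 l2 (dilation_comb R r \<phi> p) z
    = Bop n l0 l1 l2 (dilate R p) z + \<phi> * Bop n l0 l1 l2 (dilate r p) z"
  by (simp add: Bop_def dilation_comb_def pderiv_add pderiv_smult algebra_simps add_divide_distrib)

lemma dilation_comb_monom: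
  "dilation_comb R r \<phi> (monom c n) = smult (c * (of_real R ^ n + \<phi> * of_real r ^ n)) (monom 1 n)"
  by (rule poly_eqI) (auto simp: coeff_dilation_comb)

lemma continuous_on_Bop: "continuous_on A (Bop n l0 l1 l2 p)"
  unfolding Bop_def by (intro continuous_intros) auto

section \<open>Growth of a polynomial from radius r to radius R\<close>

text \<open>For fixed |a| the extreme case is \<open>a\<close> pointing opposite to
  \<open>e\<close>, where the distances are r + |a| and R + |a|; there the inequality reduces to (R
  - r) (k - |a|) >= 0.\<close>

lemma growth_factor:
  fixes a e :: complex and k R r :: real
  assumes k: "0 < k" "k \<le> r" "r < R" and a: "cmod a \<le> k" and e: "cmod e = 1"
  shows "(R + k) * cmod (of_real r * e - a) \<le> (r + k) * cmod (of_real R * e - a)"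
proof -
  define x where "x = Re (a * cnj e)"
  define b where "b = cmod a"
  have "\<bar>x\<bar> \<le> b"
    unfolding x_def b_def using abs_Re_le_cmod[of "a * cnj e"] e by (simp add: norm_mult)
  then have x: "x + b \<ge> 0" by simp
  have e2: "(Re e)^2 + (Im e)^2 = 1"
    using e by (simp add: cmod_power2 [symmetric])
  have sq: "(cmod (of_real s * e - a))^2 = s^2 - 2 * s * x + b^2" for s :: real
  proof -
    have "(cmod (of_real s * e - a))^2 = s^2 * ((Re e)^2 + (Im e)^2) - 2 * s * x + b^2"
      unfolding cmod_power2 b_def x_def by (simp add: power2_eq_square algebra_simps)
    then show ?thesis by (simp add: e2)
  qed
  have b: "0 \<le> b" "b \<le> k"
    using a by (simp_all add: b_def)
  have "(R + k) * (r + b) \<le> (r + k) * (R + b)"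
  proof -
    have "(r + k) * (R + b) - (R + k) * (r + b) = (R - r) * (k - b)"
      by (simp add: algebra_simps)
    moreover have "(R - r) * (k - b) \<ge> 0"
      using k b by simp
    ultimately show ?thesis by linarith
  qed
  then have 1: "((R + k) * (r + b))^2 \<le> ((r + k) * (R + b))^2"
    using k b by (intro power_mono) auto
  have "k * k \<le> r * R"
    using k by (intro mult_mono) auto
  then have 2: "(R - r) * (r * R - k * k) * (x + b) \<ge> 0"
    using k x by simp
  \<comment> \<open>The difference of squares is affine in \<open>x\<close>: its value at the
    extreme point \<open>x = - b\<close> plus a nonnegative multiple of
    \<open>x + b\<close>.\<close>
  have "(r + k)^2 * (R^2 - 2 * R * x + b^2) - (R + k)^2 * (r^2 - 2 * r * x + b^2)
     = ((r + k) * (R + b))^2 - ((R + k) * (r + b))^2 + 2 * ((R - r) * (r * R - k * k) * (x + b))"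
    by (simp add: power2_eq_square algebra_simps)
  with 1 2 have "(R + k)^2 * (r^2 - 2 * r * x + b^2) \<le> (r + k)^2 * (R^2 - 2 * R * x + b^2)"
    by linarith
  then have "((R + k) * cmod (of_real r * e - a))^2 \<le> ((r + k) * cmod (of_real R * e - a))^2"
    by (simp add: power_mult_distrib sq)
  then show ?thesis
    using k by (simp add: power2_le_iff_abs_le abs_mult)
qed

text \<open>Apply \<open>growth_factor\<close> to the radii r |z| and R |z|. Strictness comes from
  (R t + k) / (r t + k) exceeding (R + k) / (r + k) for t > 1, together with r z being different
  from \<open>a\<close>.\<close>

lemma growth_factor_strict:
  fixes a z :: complex and k R r :: real
  assumes k: "0 < k" "k \<le> r" "r < R" and a: "cmod a \<le> k" and z: "cmod z > 1"
  shows "(R + k) / (k + r) * cmod (of_real r * z - a) < cmod (of_real R * z - a)"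
proof -
  define t where "t = cmod z"
  define e where "e = z / of_real t"
  have t: "t > 1" using z t_def by simp
  have e: "cmod e = 1" "z = of_real t * e"
    using t by (auto simp: e_def t_def norm_divide)
  have rt: "r < r * t" "r * t < R * t"
    using k t by auto
  have "(R * t + k) * cmod (of_real (r * t) * e - a) \<le> (r * t + k) * cmod (of_real (R * t) * e - a)"
    using k rt a e by (intro growth_factor) linarith+
  then have main: "(R * t + k) * cmod (of_real r * z - a) \<le> (r * t + k) * cmod (of_real R * z - a)"
    by (simp add: e(2) mult.assoc)
  have "cmod a < cmod (of_real r * z)"
  proof -
    have "k < r * t" using k rt by linarith
    then show ?thesis using a k by (simp add: norm_mult t_def)
  qed
  then have pos: "cmod (of_real r * z - a) > 0"
    by force
  have "(R + k) * (r * t + k) < (R * t + k) * (r + k)"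
  proof -
    have "(R * t + k) * (r + k) - (R + k) * (r * t + k) = k * (R - r) * (t - 1)"
      by (simp add: algebra_simps)
    moreover have "k * (R - r) * (t - 1) > 0"
      using k t by simp
    ultimately show ?thesis by linarith
  qed
  then have "(R + k) * (r * t + k) * cmod (of_real r * z - a)
      < (r + k) * ((R * t + k) * cmod (of_real r * z - a))"
    using pos by (metis mult.assoc mult.commute mult_strict_right_mono)
  also have "\<dots> \<le> (r + k) * ((r * t + k) * cmod (of_real R * z - a))"
    using main k by (intro mult_left_mono) auto
  finally have "(r * t + k) * ((R + k) * cmod (of_real r * z - a))
      < (r * t + k) * ((r + k) * cmod (of_real R * z - a))"
    by (simp only: mult_ac)
  moreover have "r * t + k > 0" using k rt by linarith
  ultimately have "(R + k) * cmod (of_real r * z - a) < (r + k) * cmod (of_real R * z - a)"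
    by simp
  then show ?thesis
    using k by (simp add: field_simps)
qed

lemma poly_growth_strict:
  fixes G :: "complex poly"
  assumes k: "0 < k" "k \<le> r" "r < R" and deg: "degree G = n" "n \<ge> 1"
    and zeros: "\<And>w. poly G w = 0 \<Longrightarrow> cmod w \<le> k" and z: "cmod z > 1"
  shows "((R + k) / (k + r))^n * cmod (poly G (of_real r * z)) < cmod (poly G (of_real R * z))"
proof -
  obtain a where a: "smult (lead_coeff G) (\<Prod>j<n. [:- a j, 1:]) = G"
    using complex_poly_decompose'[of G] deg by metis
  have lc: "lead_coeff G \<noteq> 0"
    using deg by auto
  have ev: "poly G w = lead_coeff G * (\<Prod>j<n. w - a j)" for w
    by (subst a [symmetric]) (simp add: poly_prod)
  have ak: "cmod (a j) \<le> k" if "j < n" for j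
    using that by (intro zeros) (auto simp: ev)
  have "(\<Prod>j<n. (R + k) / (k + r) * cmod (of_real r * z - a j)) < (\<Prod>j<n. cmod (of_real R * z - a j))"
  proof (rule prod_mono_strict)
    have le: "(R + k) / (k + r) * cmod (of_real r * z - a j) < cmod (of_real R * z - a j)"
      "0 \<le> (R + k) / (k + r) * cmod (of_real r * z - a j)" if "j < n" for j
      using growth_factor_strict[OF k ak[OF that] z] k by simp_all
    show "0 \<in> {..<n}"
      "(R + k) / (k + r) * cmod (of_real r * z - a 0) < cmod (of_real R * z - a 0)"
      using le(1)[of 0] deg by simp_all
    fix j assume "j \<in> {..<n}"
    then have "j < n" by simp
    from le[OF this]
    show "0 \<le> (R + k) / (k + r) * cmod (of_real r * z - a j) \<and>
        (R + k) / (k + r) * cmod (of_real r * z - a j) \<le> cmod (of_real R * z - a j)"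
      "0 < cmod (of_real R * z - a j)"
      by linarith+
  qed auto
  then have "((R + k) / (k + r))^n * cmod (\<Prod>j<n. of_real r * z - a j) < cmod (\<Prod>j<n. of_real R * z - a j)"
    by (simp only: prod.distrib prod_norm prod_constant card_lessThan)
  then have "cmod (lead_coeff G) * (((R + k) / (k + r))^n * cmod (\<Prod>j<n. of_real r * z - a j))
      < cmod (lead_coeff G) * cmod (\<Prod>j<n. of_real R * z - a j)"
    using lc by (intro mult_strict_left_mono) auto
  then show ?thesis
    unfolding ev norm_mult by (simp only: mult_ac)
qed

text \<open>Triangle inequality; the two occurrences of |\<alpha>| cancel because the growth power
  is at least 1, hence at least |\<alpha>|.\<close>

lemma Phi_bound:
  assumes "0 < k" "k \<le> r" "r < R" "cmod \<alpha> \<le> 1" "cmod \<beta> \<le> 1"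
  shows "cmod (Phi n k R r \<alpha> \<beta>) \<le> ((R + k) / (k + r))^n"
proof -
  define S where "S = ((R + k) / (k + r))^n"
  have "S \<ge> 1"
    unfolding S_def using assms by (intro one_le_power) (simp add: field_simps)
  have "cmod (Phi n k R r \<alpha> \<beta>) \<le> cmod \<beta> * \<bar>S - cmod \<alpha>\<bar> + cmod \<alpha>"
    unfolding Phi_def S_def [symmetric]
    using norm_triangle_ineq4[of "\<beta> * complex_of_real (S - cmod \<alpha>)" \<alpha>]
    by (simp only: norm_mult norm_of_real)
  also have "\<dots> \<le> 1 * \<bar>S - cmod \<alpha>\<bar> + cmod \<alpha>"
    using assms by (intro add_mono mult_right_mono) auto
  also have "\<dots> = S"
    using \<open>S \<ge> 1\<close> assms by simp
  finally show ?thesis by (simp add: S_def)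
qed

text \<open>Vanishing would force R^n <= ((R + k) r / (k + r))^n, but (R + k) r < R (k + r). So the
  leading coefficient of a degree \<open>n\<close> polynomial survives
  \<open>dilation_comb\<close>.\<close>

lemma dilation_weight_nonzero:
  fixes k R r :: real
  assumes k: "0 < k" "k \<le> r" "r < R" and n: "n \<ge> 1"
    and \<phi>: "cmod \<phi> \<le> ((R + k) / (k + r))^n"
  shows "of_real R ^ n + \<phi> * of_real r ^ n \<noteq> 0"
proof
  assume "of_real R ^ n + \<phi> * of_real r ^ n = 0"
  then have "of_real R ^ n = - (\<phi> * of_real r ^ n)"
    by (simp add: eq_neg_iff_add_eq_0)
  then have "cmod (of_real R ^ n) = cmod (\<phi> * of_real r ^ n)"
    by simp
  then have "R ^ n = cmod \<phi> * r ^ n"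
    using k by (simp add: norm_mult norm_power)
  also have "\<dots> \<le> ((R + k) / (k + r))^n * r ^ n"
    using \<phi> k by (intro mult_right_mono) auto
  also have "\<dots> = ((R + k) / (k + r) * r) ^ n"
    by (rule power_mult_distrib [symmetric])
  also have "\<dots> < R ^ n"
    using k n by (intro power_strict_mono) (auto simp: field_simps)
  finally show False by simp
qed

text \<open>A zero with |z| > 1 would give |G(R z)| = |\<phi>| |G(r z)|, contradicting the strict
  growth of \<open>G\<close>.\<close>

lemma dilation_comb_zeros:
  fixes G :: "complex poly"
  assumes k: "0 < k" "k \<le> r" "r < R" and deg: "degree G = n" "n \<ge> 1"
    and zeros: "\<And>w. poly G w = 0 \<Longrightarrow> cmod w \<le> k"
    and \<phi>: "cmod \<phi> \<le> ((R + k) / (k + r))^n"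
  shows "degree (dilation_comb R r \<phi> G) = n"
    and "\<And>z. poly (dilation_comb R r \<phi> G) z = 0 \<Longrightarrow> cmod z \<le> 1"
proof -
  have "degree (dilation_comb R r \<phi> G) \<le> n"
    using deg by (intro degree_le) (auto simp: coeff_dilation_comb coeff_eq_0)
  moreover have "coeff (dilation_comb R r \<phi> G) n \<noteq> 0"
    using dilation_weight_nonzero[OF k deg(2) \<phi>] deg by (auto simp: coeff_dilation_comb)
  ultimately show "degree (dilation_comb R r \<phi> G) = n"
    by (simp add: le_antisym le_degree)
next
  fix z assume 0: "poly (dilation_comb R r \<phi> G) z = 0"
  show "cmod z \<le> 1"
  proof (rule ccontr)
    assume "\<not> cmod z \<le> 1"
    then have "((R + k) / (k + r))^n * cmod (poly G (of_real r * z)) < cmod (poly G (of_real R * z))"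
      by (intro poly_growth_strict[OF k deg zeros]) auto
    also have "poly G (of_real R * z) = - (\<phi> * poly G (of_real r * z))"
      using 0 by (simp add: dilation_comb_def poly_dilate eq_neg_iff_add_eq_0)
    also have "cmod \<dots> \<le> ((R + k) / (k + r))^n * cmod (poly G (of_real r * z))"
      using \<phi> by (simp add: norm_mult mult_right_mono)
    finally show False by simp
  qed
qed

section \<open>Domination on |z| > k is inherited by the images\<close>

lemma poly_eq_sum_atMost:
  fixes p :: "complex poly"
  assumes "degree p \<le> n"
  shows "poly p z = (\<Sum>i\<le>n. coeff p i * z ^ i)"
  by (subst poly_as_sum_of_monoms'[OF assms, symmetric]) (simp add: poly_sum poly_monom)

lemma poly_over_power_tendsto:
  fixes p :: "complex poly"
  assumes "degree p \<le> n"
  shows "((\<lambda>z. poly p z / z ^ n) \<longlongrightarrow> coeff p n) at_infinity"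
proof -
  have inv: "((\<lambda>z::complex. inverse z) \<longlongrightarrow> 0) at_infinity"
    by (rule tendsto_inverse_0)
  have "((\<lambda>z. \<Sum>i\<le>n. coeff p i * inverse z ^ (n - i)) \<longlongrightarrow> (\<Sum>i\<le>n. coeff p i * 0 ^ (n - i))) at_infinity"
    by (intro tendsto_intros inv)
  \<comment> \<open>As \<open>0 ^ 0 = 1\<close>, exactly the term \<open>i = n\<close>
    survives.\<close>
  also have "(\<Sum>i\<le>n. coeff p i * 0 ^ (n - i)) = (\<Sum>i\<le>n. if i = n then coeff p n else 0)"
    by (intro sum.cong) auto
  also have "\<dots> = coeff p n"
    by simp
  finally show ?thesis
  proof (rule Lim_transform_eventually)
    have "\<forall>\<^sub>F z in at_infinity. z \<noteq> (0::complex)"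
      by (rule eventually_not_equal_at_infinity)
    then show "\<forall>\<^sub>F z in at_infinity. (\<Sum>i\<le>n. coeff p i * inverse z ^ (n - i)) = poly p z / z ^ n"
    proof eventually_elim
      case (elim z)
      have "poly p z / z ^ n = (\<Sum>i\<le>n. coeff p i * z ^ i / z ^ n)"
        using poly_eq_sum_atMost[OF assms, of z] by (simp add: sum_divide_distrib)
      also have "\<dots> = (\<Sum>i\<le>n. coeff p i * inverse z ^ (n - i))"
        using elim by (intro sum.cong) (auto simp: power_diff power_inverse field_simps)
      finally show ?case by simp
    qed
  qed
qed

text \<open>Divide by z^n and let z tend to infinity. This later keeps the degree of
  \<open>f - smult \<mu> F\<close> at exactly \<open>n\<close>.\<close>

lemma coeff_le_of_poly_le:
  fixes f F :: "complex poly"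
  assumes "degree f \<le> n" "degree F \<le> n"
    and "\<And>z. cmod z > k \<Longrightarrow> cmod (poly f z) \<le> cmod (poly F z)"
  shows "cmod (coeff f n) \<le> cmod (coeff F n)"
proof (rule tendsto_le)
  show "((\<lambda>z. cmod (poly F z / z ^ n)) \<longlongrightarrow> cmod (coeff F n)) at_infinity"
    "((\<lambda>z. cmod (poly f z / z ^ n)) \<longlongrightarrow> cmod (coeff f n)) at_infinity"
    using assms by (intro tendsto_norm poly_over_power_tendsto; simp)+
  have "\<forall>\<^sub>F z in at_infinity. k + 1 \<le> cmod z"
    unfolding eventually_at_infinity by blast
  then show "\<forall>\<^sub>F z in at_infinity. cmod (poly f z / z ^ n) \<le> cmod (poly F z / z ^ n)"
    by eventually_elim (use assms(3) in \<open>auto simp: norm_divide intro: divide_right_mono\<close>)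
qed (rule trivial_limit_at_infinity)

text \<open>If the inequality failed at some \<open>y\<close> outside the closed unit disk, a
  combination of \<open>f\<close> and \<open>F\<close> of degree \<open>n\<close> with all zeros in
  |w| <= k would have an image vanishing at \<open>y\<close>. The unit circle follows by
  continuity.\<close>

lemma Bop_dilation_comb_mono:
  fixes f F :: "complex poly"
  assumes n: "n \<ge> 1"
    and U: "\<forall>w. Upoly n l0 l1 l2 w = 0 \<longrightarrow> cmod w \<le> cmod (w - of_nat n / 2)"
    and k: "0 < k" "k \<le> r" "r < R"
    and \<phi>: "cmod \<phi> \<le> ((R + k) / (k + r))^n"
    and f: "degree f \<le> n" and F: "degree F \<le> n" "coeff F n \<noteq> 0"
    and Fnz: "\<And>z. cmod z > k \<Longrightarrow> poly F z \<noteq> 0"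
    and le: "\<And>z. cmod z > k \<Longrightarrow> cmod (poly f z) \<le> cmod (poly F z)"
    and z: "cmod z \<ge> 1"
  shows "cmod (Bop n l0 l1 l2 (dilation_comb R r \<phi> f) z)
    \<le> cmod (Bop n l0 l1 l2 (dilation_comb R r \<phi> F) z)"
proof -
  let ?L = "\<lambda>p. Bop n l0 l1 l2 (dilation_comb R r \<phi> p)"
  \<comment> \<open>The two zero locations chain: \<open>dilation_comb\<close> moves the zeros into
    the closed unit disk, and \<open>Bop_nonzero\<close> is used with radius 1.\<close>
  have nz: "?L G y \<noteq> 0"
    if "degree G = n" "\<And>w. poly G w = 0 \<Longrightarrow> cmod w \<le> k" "cmod y > 1" for G y
    using Bop_nonzero[OF n U, of _ 1 y] dilation_comb_zeros[OF k that(1) n that(2) \<phi>] that(3)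
    by blast
  have strict: "cmod (?L f y) \<le> cmod (?L F y)" if y: "cmod y > 1" for y
  proof (rule ccontr)
    assume gt: "\<not> ?thesis"
    have "degree F = n"
      using F by (simp add: le_antisym le_degree)
    then have Fy: "?L F y \<noteq> 0"
      using Fnz y by (intro nz) (auto simp: not_less [symmetric])
    \<comment> \<open>By linearity this makes the image of \<open>f - smult \<mu> F\<close> vanish
      at \<open>y\<close>.\<close>
    define \<mu> where "\<mu> = ?L f y / ?L F y"
    have \<mu>: "cmod \<mu> > 1"
      using gt Fy by (simp add: \<mu>_def norm_divide)
    define H where "H = f - smult \<mu> F"
    have "cmod (coeff f n) \<le> cmod (coeff F n)"
      using coeff_le_of_poly_le[OF f F(1) le] by blast
    also have "\<dots> < cmod \<mu> * cmod (coeff F n)"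
      using \<mu> F by simp
    finally have "coeff H n \<noteq> 0"
      by (auto simp: H_def norm_mult)
    moreover have "degree H \<le> n"
      unfolding H_def using f F by (intro degree_diff_le order_trans[OF degree_smult_le]) auto
    ultimately have "degree H = n"
      by (simp add: le_antisym le_degree)
    moreover have "cmod w \<le> k" if "poly H w = 0" for w
    proof (rule ccontr)
      assume w: "\<not> cmod w \<le> k"
      then have "cmod (poly f w) \<le> cmod (poly F w)" "poly F w \<noteq> 0"
        using le Fnz by auto
      moreover from this have "cmod (poly F w) < cmod \<mu> * cmod (poly F w)"
        using \<mu> by simp
      moreover have "cmod (poly f w) = cmod \<mu> * cmod (poly F w)"
        using that by (simp add: H_def norm_mult)
      ultimately show False by linarith
    qed
    ultimately have "?L H y \<noteq> 0"
      using nz y by blast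
    then show False
      using Fy by (simp add: H_def dilation_comb_diff_smult Bop_diff_smult \<mu>_def)
  qed
  \<comment> \<open>Approach \<open>z\<close> radially from outside through \<open>t * z\<close>
    with t > 1.\<close>
  have lim: "((\<lambda>t. cmod (?L p (of_real t * z))) \<longlongrightarrow> cmod (?L p (of_real 1 * z))) (at_right 1)" for p
  proof -
    have "isCont (?L p) w" for w
      using continuous_on_Bop[of UNIV] by (simp add: continuous_on_eq_continuous_at)
    then show ?thesis
      by (intro tendsto_norm isCont_tendsto_compose[where g = "?L p"] tendsto_intros)
  qed
  have "\<forall>\<^sub>F t in at_right (1::real). t > 1"
    by (rule eventually_at_right_less)
  then have "\<forall>\<^sub>F t in at_right 1. cmod (?L f (of_real t * z)) \<le> cmod (?L F (of_real t * z))"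
  proof eventually_elim
    case (elim t)
    then have "1 * 1 < t * cmod z"
      using z by (intro mult_less_le_imp_less) auto
    then show ?case
      using elim by (intro strict) (simp add: norm_mult)
  qed
  then have "cmod (?L f (of_real 1 * z)) \<le> cmod (?L F (of_real 1 * z))"
    by (intro tendsto_le[OF _ lim lim]) auto
  then show ?thesis by simp
qed

section \<open>Reflection in a circle\<close>

text \<open>The polynomial (z/k)^n cnj (P (k^2 / cnj z)), given by coefficients so that the origin
  needs no separate treatment. The reflection is relative to the nominal degree \<open>n\<close>,
  and the quotient of powers stands for k^(2j - n), whose exponent may be negative.\<close>

definition circle_reflect :: "nat \<Rightarrow> real \<Rightarrow> complex poly \<Rightarrow> complex poly" where
  "circle_reflect n k P = (\<Sum>j\<le>n. monom (cnj (coeff P j) * of_real (k ^ (2 * j) / k ^ n)) (n - j))"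

lemma poly_circle_reflect:
  assumes "degree P \<le> n" "z \<noteq> 0" "k > 0"
  shows "poly (circle_reflect n k P) z = (z / of_real k) ^ n * cnj (poly P (of_real (k^2) / cnj z))"
proof -
  have "cnj (poly P (of_real (k^2) / cnj z)) = (\<Sum>j\<le>n. cnj (coeff P j) * (of_real (k^2) / z) ^ j)"
    by (simp add: poly_eq_sum_atMost[OF assms(1)])
  moreover have "cnj (coeff P j) * of_real (k ^ (2 * j) / k ^ n) * z ^ (n - j)
      = (z / of_real k) ^ n * (cnj (coeff P j) * (of_real (k^2) / z) ^ j)" if "j \<le> n" for j
    using that assms by (simp add: power_divide power_diff field_simps flip: power_mult)
  ultimately show ?thesis
    by (simp add: circle_reflect_def poly_sum poly_monom sum_distrib_left)
qed

lemma degree_circle_reflect: "degree (circle_reflect n k P) \<le> n"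
  unfolding circle_reflect_def
  by (intro degree_sum_le) (auto intro: order_trans[OF degree_monom_le])

lemma coeff_circle_reflect: "coeff (circle_reflect n k P) n = cnj (coeff P 0) / of_real (k ^ n)"
proof -
  have "coeff (circle_reflect n k P) n
      = (\<Sum>j\<le>n. if j = 0 then cnj (coeff P 0) / of_real (k ^ n) else 0)"
    unfolding circle_reflect_def coeff_sum by (intro sum.cong) auto
  then show ?thesis by simp
qed

text \<open>Only the summand \<open>j = 0\<close> sees the constant term, and it sits in degree
  \<open>n\<close>.\<close>

lemma circle_reflect_diff_const:
  "circle_reflect n k (P - [:c:]) = circle_reflect n k P - smult (cnj c / of_real (k ^ n)) (monom 1 n)"
proof -
  have "circle_reflect n k P - circle_reflect n k (P - [:c:])
      = (\<Sum>j\<le>n. if j = 0 then monom (cnj c / of_real (k ^ n)) n else 0)"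
    unfolding circle_reflect_def sum_subtractf [symmetric]
    by (intro sum.cong) (auto simp: diff_monom algebra_simps diff_divide_distrib coeff_pCons split: nat.splits)
  then show ?thesis
    by (simp add: smult_monom algebra_simps)
qed

text \<open>After clearing denominators and squaring, the two sides differ by (|a|^2 - k^2) (|z|^2 -
  k^2).\<close>

lemma blaschke_factor_le:
  fixes z a :: complex
  assumes k: "0 < k" "k \<le> cmod a" "k \<le> cmod z"
  shows "cmod (z - a) \<le> cmod z / k * cmod (of_real (k^2) / cnj z - a)"
proof -
  have z: "z \<noteq> 0" using k by auto
  have "cmod z / k * cmod (of_real (k^2) / cnj z - a) = cmod (cnj z * (of_real (k^2) / cnj z - a)) / k"
    by (simp add: norm_mult)
  also have "cnj z * (of_real (k^2) / cnj z - a) = of_real (k^2) - cnj z * a"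
    using z by (simp add: algebra_simps)
  finally have eq: "cmod z / k * cmod (of_real (k^2) / cnj z - a) = cmod (of_real (k^2) - cnj z * a) / k" .
  have "k^2 \<le> (cmod a)^2" "k^2 \<le> (cmod z)^2"
    using k by (simp_all add: power_mono)
  then have "((cmod a)^2 - k^2) * ((cmod z)^2 - k^2) \<ge> 0"
    by simp
  moreover have "(cmod (of_real (k^2) - cnj z * a))^2 - (k * cmod (z - a))^2
      = ((cmod a)^2 - k^2) * ((cmod z)^2 - k^2)"
    unfolding power_mult_distrib cmod_power2 by (simp add: power2_eq_square algebra_simps)
  ultimately have "(k * cmod (z - a))^2 \<le> (cmod (of_real (k^2) - cnj z * a))^2"
    by linarith
  then have "k * cmod (z - a) \<le> cmod (of_real (k^2) - cnj z * a)"
    by (rule power2_le_imp_le) simp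
  then show ?thesis
    unfolding eq using k by (simp add: field_simps)
qed

text \<open>Multiply \<open>blaschke_factor_le\<close> over the roots; the remaining power of |z| /
  k, with exponent \<open>n\<close> minus the degree, is at least 1.\<close>

lemma poly_le_circle_reflect:
  fixes P :: "complex poly"
  assumes k: "0 < k" "k \<le> cmod z" and deg: "degree P \<le> n"
    and nz: "\<And>w. cmod w < k \<Longrightarrow> poly P w \<noteq> 0"
  shows "cmod (poly P z) \<le> cmod (poly (circle_reflect n k P) z)"
proof -
  define d where "d = degree P"
  define y where "y = of_real (k^2) / cnj z"
  obtain a where a: "smult (lead_coeff P) (\<Prod>j<d. [:- a j, 1:]) = P"
    using complex_poly_decompose'[of P] d_def by metis
  have ev: "poly P w = lead_coeff P * (\<Prod>j<d. w - a j)" for w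
    by (subst a [symmetric]) (simp add: poly_prod)
  have ak: "k \<le> cmod (a j)" if "j < d" for j
    using that nz[of "a j"] by (force simp: ev not_less [symmetric])
  have z: "z \<noteq> 0" using k by auto
  have "cmod (\<Prod>j<d. z - a j) \<le> (\<Prod>j<d. cmod z / k * cmod (y - a j))"
    unfolding prod_norm [symmetric] y_def using ak k
    by (intro prod_mono) (auto intro!: blaschke_factor_le simp del: of_real_power times_divide_eq_left)
  also have "\<dots> = (cmod z / k) ^ d * cmod (\<Prod>j<d. y - a j)"
    by (simp only: prod.distrib prod_norm prod_constant card_lessThan)
  also have "\<dots> \<le> (cmod z / k) ^ n * cmod (\<Prod>j<d. y - a j)"
    using k deg d_def by (intro mult_right_mono power_increasing) auto
  finally have "cmod (lead_coeff P) * cmod (\<Prod>j<d. z - a j)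
      \<le> cmod (lead_coeff P) * ((cmod z / k) ^ n * cmod (\<Prod>j<d. y - a j))"
    by (intro mult_left_mono) auto
  then have "cmod (poly P z) \<le> (cmod z / k) ^ n * cmod (poly P y)"
    unfolding ev norm_mult by (simp only: mult_ac)
  also have "\<dots> = cmod (poly (circle_reflect n k P) z)"
    unfolding poly_circle_reflect[OF deg z k(1)] y_def
    using k by (simp add: norm_mult norm_power norm_divide)
  finally show ?thesis .
qed

text \<open>Maximum modulus on the closed disk. Compactness of the circle supplies the boundedness
  without which the real supremum would not be an upper bound.\<close>

lemma poly_le_SUP_circle:
  fixes P :: "complex poly"
  assumes "cmod w \<le> k"
  shows "cmod (poly P w) \<le> (SUP w\<in>{w. cmod w = k}. cmod (poly P w))"
proof (rule maximum_modulus_frontier[where f = "poly P" and S = "cball 0 k"])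
  fix v assume v: "v \<in> frontier (cball 0 k :: complex set)"
  have "{w. cmod w = k} = sphere 0 k"
    by (auto simp: dist_norm)
  then have "compact ((\<lambda>w. cmod (poly P w)) ` {w. cmod w = k})"
    by (auto intro!: compact_continuous_image continuous_intros)
  then have "bdd_above ((\<lambda>w. cmod (poly P w)) ` {w. cmod w = k})"
    by (intro bounded_imp_bdd_above compact_imp_bounded)
  moreover have "v \<in> {w. cmod w = k}"
    using v by (cases "k = 0") (auto simp: frontier_def dist_norm)
  ultimately show "cmod (poly P v) \<le> (SUP w\<in>{w. cmod w = k}. cmod (poly P w))"
    by (intro cSUP_upper)
qed (use assms in \<open>auto intro!: continuous_intros holomorphic_intros\<close>)

text \<open>Rotate \<open>b\<close> onto the ray of \<open>a\<close>. One \<open>c\<close> serves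
  every real \<open>s\<close>, so it can be fixed before the scaling parameter varies.\<close>

lemma exists_unit_aligning:
  fixes a b :: complex
  obtains c where "cmod c = 1" "\<And>s. cmod (a - of_real s * c * b) = \<bar>cmod a - s * cmod b\<bar>"
proof
  define c where "c = cis (Arg a - Arg b)"
  show "cmod c = 1" by (simp add: c_def)
  fix s :: real
  have "c * cis (Arg b) = cis (Arg a)"
    by (simp add: c_def cis_mult)
  moreover have "a = of_real (cmod a) * cis (Arg a)" "b = of_real (cmod b) * cis (Arg b)"
    by (metis rcis_cmod_Arg rcis_def)+
  ultimately have "a - of_real s * c * b = of_real (cmod a - s * cmod b) * cis (Arg a)"
    by (metis (no_types, lifting) left_diff_distrib mult.assoc mult.left_commute of_real_diff of_real_mult)
  then show "cmod (a - of_real s * c * b) = \<bar>cmod a - s * cmod b\<bar>"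
    by (simp only: norm_mult norm_of_real norm_cis mult_1_right)
qed

section \<open>The sum of the bounds for P and its reflection\<close>

theorem theorem2p6:
  fixes n :: nat and k R r :: real and l0 l1 l2 \<alpha> \<beta> z :: complex and P :: "complex poly"
  assumes "n \<ge> 1"
    and "\<forall>w. Upoly n l0 l1 l2 w = 0 \<longrightarrow> cmod w \<le> cmod (w - of_nat n / 2)"
    and "0 < k" and "k \<le> 1"
    and "degree P \<le> n"
    and "\<forall>w. cmod w < k \<longrightarrow> poly P w \<noteq> 0"
    and "cmod \<alpha> \<le> 1" and "cmod \<beta> \<le> 1"
    and "R > r" and "r \<ge> k"
    and "cmod z \<ge> 1"
  shows "cmod (Bop n l0 l1 l2 (pcompose P [:0, complex_of_real R:]) z
               + Phi n k R r \<alpha> \<beta> * Bop n l0 l1 l2 (pcompose P [:0, complex_of_real r:]) z)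
         \<le> 1/2 * (cmod (Bop n l0 l1 l2 (monom 1 n) z) / k^n
                    * cmod (complex_of_real (R^n) + complex_of_real (r^n) * Phi n k R r \<alpha> \<beta>)
                  + cmod (1 + Phi n k R r \<alpha> \<beta>) * cmod l0)
           * (SUP w\<in>{w. cmod w = k}. cmod (poly P w))"
proof -
  define M where "M = (SUP w\<in>{w. cmod w = k}. cmod (poly P w))"
  define \<phi> where "\<phi> = Phi n k R r \<alpha> \<beta>"
  define L where "L p = Bop n l0 l1 l2 (dilation_comb R r \<phi> p) z" for p
  define W where "W = L (monom 1 n) / of_real (k ^ n)"
  define Q where "Q = circle_reflect n k P"
  have k: "0 < k" "k \<le> r" "r < R" using assms by simp_all
  have \<phi>: "cmod \<phi> \<le> ((R + k) / (k + r))^n"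
    unfolding \<phi>_def using Phi_bound[OF k assms(7,8)] .
  note mono = Bop_dilation_comb_mono[OF assms(1,2) k \<phi> _ _ _ _ _ assms(11), folded L_def]
  have PM: "cmod (poly P w) \<le> M" if "cmod w \<le> k" for w
    unfolding M_def using that by (rule poly_le_SUP_circle)
  have "poly P 0 \<noteq> 0"
    using assms by simp
  then have M: "M > 0"
    using PM[of 0] k by (metis less_le_trans less_imp_le norm_zero zero_less_norm_iff)
  have L_diff: "L (p - smult c q) = L p - c * L q" for p q c
    by (simp add: L_def dilation_comb_diff_smult Bop_diff_smult)
  have L_const: "L [:c:] = c * (l0 * (1 + \<phi>))" for c
    by (simp add: L_def Bop_def dilation_comb_def dilate_def pderiv_pCons algebra_simps)
  have LP_LQ: "cmod (L G) \<le> cmod (L (circle_reflect n k G))"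
    if G: "degree G \<le> n" "\<And>w. cmod w < k \<Longrightarrow> poly G w \<noteq> 0" for G
  proof (rule mono[OF G(1) degree_circle_reflect])
    have "poly G 0 \<noteq> 0" using G k by simp
    then show "coeff (circle_reflect n k G) n \<noteq> 0"
      using k by (simp add: coeff_circle_reflect poly_0_coeff_0)
  next
    fix y assume y: "cmod y > k"
    then have "y \<noteq> 0" using k by auto
    \<comment> \<open>The reflected point falls into the open disk, where \<open>G\<close> has no
      zeros.\<close>
    moreover have "cmod (of_real (k^2) / cnj y) < k"
      using y k \<open>y \<noteq> 0\<close> by (simp add: norm_divide norm_power divide_less_eq) (simp add: power2_eq_square)
    ultimately show "poly (circle_reflect n k G) y \<noteq> 0"
      using G k by (simp add: poly_circle_reflect del: of_real_power)
    show "cmod (poly G y) \<le> cmod (poly (circle_reflect n k G) y)"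
      using y k G by (intro poly_le_circle_reflect) auto
  qed
  have LQ_W: "cmod (L Q) \<le> M * cmod W"
  proof -
    have "cmod (L Q) \<le> cmod (L (smult (of_real (M / k ^ n)) (monom 1 n)))"
    proof (rule mono)
      show "degree Q \<le> n"
        by (simp add: Q_def degree_circle_reflect)
      show "degree (smult (of_real (M / k ^ n)) (monom 1 n) :: complex poly) \<le> n"
        by (rule order_trans[OF degree_smult_le degree_monom_le])
      show "coeff (smult (complex_of_real (M / k ^ n)) (monom 1 n)) n \<noteq> 0"
        using k M by simp
    next
      fix y assume y: "cmod y > k"
      then have y0: "y \<noteq> 0" using k by auto
      then show "poly (smult (complex_of_real (M / k ^ n)) (monom 1 n)) y \<noteq> 0"
        using k M by (simp add: poly_monom)
      \<comment> \<open>At the reflected point |P| is at most \<open>M\<close>, which bounds |Q(y)|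
        by M (|y| / k)^n, the modulus of the comparison monomial.\<close>
      have "cmod (of_real (k^2) / cnj y) \<le> k"
        using y k y0 by (simp add: norm_divide norm_power divide_le_eq) (simp add: power2_eq_square)
      then have "cmod (poly Q y) \<le> (cmod y / k) ^ n * M"
        unfolding Q_def poly_circle_reflect[OF assms(5) y0 k(1)] norm_mult complex_mod_cnj
        using k by (intro mult_mono PM) (auto simp: norm_power norm_divide)
      also have "\<dots> = cmod (poly (smult (complex_of_real (M / k ^ n)) (monom 1 n)) y)"
        using k M by (simp add: poly_monom norm_mult norm_power norm_divide power_divide)
      finally show "cmod (poly Q y) \<le> cmod (poly (smult (complex_of_real (M / k ^ n)) (monom 1 n)) y)" .
    qed
    also have "L (smult (of_real (M / k ^ n)) (monom 1 n)) = of_real M * W"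
      \<comment> \<open>Homogeneity is read off from \<open>L_diff\<close> by writing the multiple
        as 0 minus its negative.\<close>
      using L_diff[of 0 "- of_real (M / k ^ n)" "monom 1 n"] L_const[of 0] by (simp add: W_def)
    finally show ?thesis
      using M by (simp add: norm_mult)
  qed
  obtain c where c: "cmod c = 1" "\<And>s. cmod (L Q - of_real s * c * W) = \<bar>cmod (L Q) - s * cmod W\<bar>"
    using exists_unit_aligning[of "L Q" W] by metis
  have bound: "cmod (L P) + cmod (L Q) \<le> t * M * (cmod W + cmod (1 + \<phi>) * cmod l0)" if t: "t > 1" for t
  proof -
    \<comment> \<open>The modulus \<open>t * M\<close> exceeds \<open>M\<close>, so
      \<open>P - [:\<gamma>:]\<close> has no zero in the disk; the conjugate is there because
      reflection conjugates the constant, leaving \<open>c\<close> next to \<open>W\<close>.\<close>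
    define \<gamma> where "\<gamma> = of_real (t * M) * cnj c"
    have tM: "M < t * M" using t M by simp
    have \<gamma>: "cmod \<gamma> = t * M"
      using t M c by (simp add: \<gamma>_def norm_mult)
    have "cmod (L (P - [:\<gamma>:])) \<le> cmod (L (circle_reflect n k (P - [:\<gamma>:])))"
    proof (rule LP_LQ)
      show "degree (P - [:\<gamma>:]) \<le> n"
        using assms by (intro degree_diff_le) auto
      fix w :: complex assume "cmod w < k"
      then show "poly (P - [:\<gamma>:]) w \<noteq> 0"
        using PM[of w] \<gamma> tM by auto
    qed
    also have "L (circle_reflect n k (P - [:\<gamma>:])) = L Q - of_real (t * M) * c * W"
      by (simp add: circle_reflect_diff_const L_diff Q_def W_def \<gamma>_def)
    also have "cmod \<dots> = t * M * cmod W - cmod (L Q)"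
    proof -
      \<comment> \<open>With \<open>LQ_W\<close> this settles the sign inside the absolute value
        from the choice of \<open>c\<close>, so |L Q| appears with a minus sign and can be moved to
        the left side.\<close>
      have "M * cmod W \<le> t * M * cmod W"
        using tM by (intro mult_right_mono) auto
      then show ?thesis
        unfolding c(2) using LQ_W by simp
    qed
    finally have "cmod (L (P - [:\<gamma>:])) \<le> t * M * cmod W - cmod (L Q)" .
    moreover have "L (P - [:\<gamma>:]) = L P - \<gamma> * (l0 * (1 + \<phi>))"
      using L_diff[of P \<gamma> "[:1:]"] L_const[of 1] by simp
    moreover have "cmod (L P) - cmod (\<gamma> * (l0 * (1 + \<phi>))) \<le> cmod (L P - \<gamma> * (l0 * (1 + \<phi>)))"
      by (rule norm_triangle_ineq2)
    moreover have "cmod (\<gamma> * (l0 * (1 + \<phi>))) = t * M * (cmod (1 + \<phi>) * cmod l0)"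
      by (simp add: norm_mult \<gamma>)
    ultimately show ?thesis
      by (simp add: algebra_simps)
  qed
  have "cmod (L P) + cmod (L Q) \<le> 1 * M * (cmod W + cmod (1 + \<phi>) * cmod l0)"
  proof (rule tendsto_lowerbound)
    show "((\<lambda>t. t * M * (cmod W + cmod (1 + \<phi>) * cmod l0)) \<longlongrightarrow> 1 * M * (cmod W + cmod (1 + \<phi>) * cmod l0)) (at_right 1)"
      by (intro tendsto_intros)
    show "\<forall>\<^sub>F t in at_right 1. cmod (L P) + cmod (L Q) \<le> t * M * (cmod W + cmod (1 + \<phi>) * cmod l0)"
      using eventually_at_right_less[of "1::real"] by eventually_elim (rule bound)
  qed auto
  \<comment> \<open>Replacing |L Q| by the smaller |L P| in the sum bound produces the factor
    1/2.\<close>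
  moreover have "cmod (L P) \<le> cmod (L Q)"
    unfolding Q_def using assms by (intro LP_LQ) auto
  ultimately have "cmod (L P) \<le> 1/2 * (cmod W + cmod (1 + \<phi>) * cmod l0) * M"
    by (simp add: algebra_simps)
  moreover have "L P = Bop n l0 l1 l2 (pcompose P [:0, complex_of_real R:]) z
      + \<phi> * Bop n l0 l1 l2 (pcompose P [:0, complex_of_real r:]) z"
    by (simp add: L_def Bop_dilation_comb dilate_def)
  moreover have "cmod W = cmod (Bop n l0 l1 l2 (monom 1 n) z) / k^n
      * cmod (complex_of_real (R^n) + complex_of_real (r^n) * \<phi>)"
    using k by (simp add: W_def L_def dilation_comb_monom Bop_smult norm_mult norm_divide norm_power mult.commute)
  ultimately show ?thesis
    unfolding M_def \<phi>_def by simp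
qed

end
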